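(* Let $q:\Gamma\to\overline{\Gamma}=\Gamma/Z(\Gamma)$ be the quotient map. Then the composition $q\circ\beta:B_3\to\overline{\Gamma}$ is not surjective. Moreover, $[\overline{\Gamma}:q\circ\beta(B_3)]=\infty$.
   Context: Let $B_3$ be the braid group on three strands with standard generators $\sigma_1,\sigma_2$. The (unreduced) Burau representation $\beta:B_3\to\mathrm{GL}(3,\mathbb{Z}[t,t^{-1}])$ is given by $\beta(\sigma_1)=\begin{pmatrix}1-t&t&0\\1&0&0\\0&0&1\end{pmatrix}$, $\beta(\sigma_2)=\begin{pmatrix}1&0&0\\0&1-t&t\\0&1&0\end{pmatrix}$. For a matrix $A$ with Laurent polynomial entries, $\overline{A}$ denotes the matrix obtained by substituting $t\mapsto t^{-1}$ in every entry. Let $J_3=\begin{pmatrix}1&-t^{-1}&-t^{-1}\\-t&1&-t^{-1}\\-t&-t&1\end{pmatrix}$, $v=(t,t^2,t^3)$ (a row vector) and $\vec{1}=(1,1,1)^T$. Salter's group is $\Gamma=\{A\in\mathrm{GL}(3,\mathbb{Z}[t,t^{-1}]) : vA=v,\ A\vec 1=\vec 1,\ \overline{A}J_3A^T=J_3,\ A|_{t=1}\text{ is a }3\times 3\text{ permutation matrix}\}$, and $Z(\Gamma)$ denotes its center. *)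

theory Defs
  imports "HOL-Analysis.Analysis" "HOL-Computational_Algebra.Formal_Laurent_Series"
          "HOL-Algebra.Algebra"
begin

text \<open>Laurent polynomials Z[t,t^-1] are realised inside the formal Laurent series
  over int as those with finitely many nonzero coefficients; t is fls_X.\<close>

type_synonym lpoly = "int fls"
type_synonym lmat = "lpoly ^ 3 ^ 3"

definition laurent_poly :: "lpoly \<Rightarrow> bool" where
  "laurent_poly f \<longleftrightarrow> finite {n. fls_nth f n \<noteq> 0}"

text \<open>Substitution t to t^-1 (applied only to Laurent polynomials).\<close>
definition lbar :: "lpoly \<Rightarrow> lpoly" where
  "lbar f = Abs_fls (\<lambda>n. fls_nth f (- n))"

text \<open>Evaluation at t = 1.\<close>
definition eval1 :: "lpoly \<Rightarrow> int" where
  "eval1 f = (\<Sum>n\<in>{n. fls_nth f n \<noteq> 0}. fls_nth f n)"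

definition mbar :: "lmat \<Rightarrow> lmat" where
  "mbar A = (\<chi> i j. lbar (A $ i $ j))"

definition laurent_mat :: "lmat \<Rightarrow> bool" where
  "laurent_mat A \<longleftrightarrow> (\<forall>i j. laurent_poly (A $ i $ j))"

text \<open>GL(3, Z[t,t^-1]).\<close>
definition GL3 :: "lmat set" where
  "GL3 = {A. laurent_mat A \<and> (\<exists>B. laurent_mat B \<and> A ** B = mat 1 \<and> B ** A = mat 1)}"

definition idx3 :: "3 \<Rightarrow> nat" where
  "idx3 i = (if i = 1 then 0 else if i = 2 then 1 else 2)"

definition mat3 :: "lpoly list list \<Rightarrow> lmat" where
  "mat3 rs = (\<chi> i j. rs ! idx3 i ! idx3 j)"

definition vec3 :: "lpoly list \<Rightarrow> lpoly ^ 3" where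
  "vec3 xs = (\<chi> i. xs ! idx3 i)"

abbreviation t :: lpoly where "t \<equiv> fls_X"
abbreviation tinv :: lpoly where "tinv \<equiv> fls_X_inv"

definition burau_s1 :: lmat where
  "burau_s1 = mat3 [[1 - t, t, 0], [1, 0, 0], [0, 0, 1]]"

definition burau_s2 :: lmat where
  "burau_s2 = mat3 [[1, 0, 0], [0, 1 - t, t], [0, 1, 0]]"

definition J3 :: lmat where
  "J3 = mat3 [[1, - tinv, - tinv], [- t, 1, - tinv], [- t, - t, 1]]"

definition vrow :: "lpoly ^ 3" where
  "vrow = vec3 [t, t^2, t^3]"

definition ones3 :: "lpoly ^ 3" where
  "ones3 = vec3 [1, 1, 1]"

definition is_perm_matrix :: "int ^ 3 ^ 3 \<Rightarrow> bool" where
  "is_perm_matrix P \<longleftrightarrow> (\<exists>p. p permutes (UNIV :: 3 set) \<and>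
       (\<forall>i j. P $ i $ j = (if p i = j then 1 else 0)))"

text \<open>Salter's group.\<close>
definition Gamma :: "lmat set" where
  "Gamma = {A \<in> GL3. vrow v* A = vrow \<and> A *v ones3 = ones3 \<and>
              mbar A ** J3 ** transpose A = J3 \<and>
              is_perm_matrix (\<chi> i j. eval1 (A $ i $ j))}"

definition Gamma_grp :: "lmat monoid" where
  "Gamma_grp = \<lparr>carrier = Gamma, mult = (**), one = mat 1\<rparr>"

definition grp_center :: "('a, 'b) monoid_scheme \<Rightarrow> 'a set" where
  "grp_center G = {z \<in> carrier G. \<forall>g \<in> carrier G. z \<otimes>\<^bsub>G\<^esub> g = g \<otimes>\<^bsub>G\<^esub> z}"

text \<open>The quotient map q : Gamma \<rightarrow> Gamma / Z(Gamma).\<close>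
definition qmap :: "lmat \<Rightarrow> lmat set" where
  "qmap A = grp_center Gamma_grp #>\<^bsub>Gamma_grp\<^esub> A"

definition Gamma_bar :: "lmat set monoid" where
  "Gamma_bar = Gamma_grp Mod grp_center Gamma_grp"

text \<open>beta(B_3) is the subgroup generated by beta(sigma_1), beta(sigma_2).\<close>
definition burau_image :: "lmat set" where
  "burau_image = generate Gamma_grp {burau_s1, burau_s2}"

end

(*
  Specialising the reduced Burau representation at t = -1 sends Salter's group to GL(2, Z), and B_3
  modulo its centre embeds into PSL(2, Z) there. Hence an element of Salter's group that is the
  identity at t = -1 has distinct powers modulo the Burau image and the centre, unless some power of
  it is central. Such an element is s1^-6 A s2^-20, where A is an explicit matrix in Salter's group
  with the same value at t = -1 as s1^6 s2^20.
*)
theory Submission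
  imports Defs
begin

text \<open>At t = -1 the two reduced generators become elementary matrices generating SL(2, Z).
  Hence every element of \<open>Gamma\<close> whose reduced value there has determinant 1 can be
  corrected by a Burau matrix to an element that is trivial at -1. The difficulty is therefore to
  exhibit one element for which the corrected matrix is not central. The centre of
  \<open>Gamma\<close> is never computed. Its place is taken by the elements of \<open>Gamma\<close>
  that commute with both generators: they include the centre and the full twist, and they reduce to
  1 or -1 at t = -1. A power of the corrected element K cannot become central: in the reduced
  representation K^n = U K + V with U(-1) = n, so U is nonzero and an off-diagonal entry of K
  survives.\<close>

unbundle no Formal_Power_Series.fps_syntax

subsection \<open>Laurent polynomials\<close>

definition lmono :: "int \<Rightarrow> int \<Rightarrow> lpoly" where
  "lmono c n = fls_shift (- n) (fls_const c)"

lemma lmono_nth [simp]: "fls_nth (lmono c n) k = (if k = n then c else 0)"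
  by (auto simp: lmono_def)

lemma lmono_mult: "lmono c m * lmono d n = lmono (c * d) (m + n)"
  by (simp add: lmono_def fls_times_both_shifted_simp)

lemma laurent_polyI: "finite S \<Longrightarrow> (\<And>n. n \<notin> S \<Longrightarrow> fls_nth f n = 0) \<Longrightarrow> laurent_poly f"
  unfolding laurent_poly_def by (rule finite_subset[of _ S]) auto

lemma laurent_poly_lmono [simp]: "laurent_poly (lmono c n)"
  by (rule laurent_polyI[of "{n}"]) auto

lemma laurent_poly_0 [simp]: "laurent_poly 0"
  by (simp add: laurent_poly_def)

lemma laurent_poly_const [simp]: "laurent_poly (fls_const c)"
  by (rule laurent_polyI[of "{0}"]) auto

lemma laurent_poly_1 [simp]: "laurent_poly 1"
  by (rule laurent_polyI[of "{0}"]) (simp_all split: if_splits)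

lemma laurent_poly_t [simp]: "laurent_poly t"
  by (rule laurent_polyI[of "{1}"]) (simp_all split: if_splits)

lemma laurent_poly_tinv [simp]: "laurent_poly tinv"
  by (rule laurent_polyI[of "{-1}"]) (simp_all split: if_splits)

lemma laurent_poly_add [simp]:
  assumes "laurent_poly f" "laurent_poly g" shows "laurent_poly (f + g)"
  using assms
  by (intro laurent_polyI[of "{n. fls_nth f n \<noteq> 0} \<union> {n. fls_nth g n \<noteq> 0}"])
     (simp_all add: laurent_poly_def)

lemma laurent_poly_uminus [simp]: "laurent_poly (- f) \<longleftrightarrow> laurent_poly f"
  by (simp add: laurent_poly_def)

lemma laurent_poly_diff [simp]:
  "laurent_poly f \<Longrightarrow> laurent_poly g \<Longrightarrow> laurent_poly (f - g)"
  using laurent_poly_add[of f "- g"] by simp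

lemma laurent_poly_sum [simp]:
  "(\<And>x. x \<in> S \<Longrightarrow> laurent_poly (f x)) \<Longrightarrow> laurent_poly (sum f S)"
  by (induction S rule: infinite_finite_induct) auto

lemma laurent_poly_expand:
  assumes "laurent_poly f"
  shows "f = (\<Sum>n\<in>{n. fls_nth f n \<noteq> 0}. lmono (fls_nth f n) n)"
  using assms unfolding laurent_poly_def
  by (intro fls_eqI) (auto simp: fls_nth_sum)

text \<open>Bar and evaluation are additive, so their multiplicativity has to be checked on
  monomials only; this induction performs the reduction.\<close>

lemma laurent_poly_induct [consumes 1, case_names mono add]:
  assumes "laurent_poly f"
    and mono: "\<And>c n. P (lmono c n)"
    and add: "\<And>f g. laurent_poly f \<Longrightarrow> laurent_poly g \<Longrightarrow> P f \<Longrightarrow> P g \<Longrightarrow> P (f + g)"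
  shows "P f"
proof -
  have P0: "P 0" using mono[of 0 0] by (simp add: lmono_def)
  have "P (\<Sum>n\<in>S. lmono (c n) n)" if "finite S" for S and c :: "int \<Rightarrow> int"
    using that
  proof (induction S rule: finite_induct)
    case (insert n S)
    then show ?case using add[OF _ _ mono insert.IH, of "c n" n] by simp
  qed (simp add: P0)
  then show ?thesis
    using laurent_poly_expand[OF assms(1)] assms(1) unfolding laurent_poly_def by metis
qed

lemma laurent_poly_mult [simp]:
  assumes "laurent_poly f" "laurent_poly g" shows "laurent_poly (f * g)"
  using assms(1)
proof (induction f rule: laurent_poly_induct)
  case (mono c m)
  show ?case using assms(2)
    by (induction g rule: laurent_poly_induct) (auto simp: lmono_mult ring_distribs)
qed (auto simp: ring_distribs)

lemma laurent_poly_power [simp]: "laurent_poly f \<Longrightarrow> laurent_poly (f ^ n)"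
  by (induction n) auto

lemma lbar_nth:
  assumes "laurent_poly f" shows "fls_nth (lbar f) n = fls_nth f (- n)"
  unfolding lbar_def
proof (subst nth_Abs_fls)
  have "finite (int -` {n. fls_nth f n \<noteq> 0})"
    using assms by (intro finite_vimageI) (simp_all add: laurent_poly_def)
  then show "\<forall>\<^sub>\<infinity>n. fls_nth f (- (- int n)) = 0"
    by (simp add: eventually_cofinite vimage_def)
qed simp

lemma lbar_lmono: "lbar (lmono c n) = lmono c (- n)"
  by (intro fls_eqI) (auto simp: lbar_nth)

lemma lbar_add:
  "laurent_poly f \<Longrightarrow> laurent_poly g \<Longrightarrow> lbar (f + g) = lbar f + lbar g"
  by (intro fls_eqI) (auto simp: lbar_nth)

lemma lbar_diff: "laurent_poly f \<Longrightarrow> laurent_poly g \<Longrightarrow> lbar (f - g) = lbar f - lbar g"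
  by (intro fls_eqI) (auto simp: lbar_nth)

lemma lbar_0 [simp]: "lbar 0 = 0"
  by (intro fls_eqI) (auto simp: lbar_nth)

lemma lbar_sum:
  "(\<And>x. x \<in> S \<Longrightarrow> laurent_poly (f x)) \<Longrightarrow> lbar (sum f S) = (\<Sum>x\<in>S. lbar (f x))"
  by (induction S rule: infinite_finite_induct) (auto simp: lbar_add)

lemma lbar_mult:
  assumes "laurent_poly f" "laurent_poly g" shows "lbar (f * g) = lbar f * lbar g"
  using assms(1)
proof (induction f rule: laurent_poly_induct)
  case (mono c m)
  show ?case using assms(2)
    by (induction g rule: laurent_poly_induct)
       (auto simp: lmono_mult lbar_lmono lbar_add ring_distribs)
qed (use assms(2) in \<open>auto simp: lbar_add ring_distribs\<close>)

lemma lbar_const [simp]: "lbar (fls_const c) = fls_const c"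
  by (intro fls_eqI) (auto simp: lbar_nth)

lemma lbar_1 [simp]: "lbar 1 = 1"
  by (intro fls_eqI) (auto simp: lbar_nth)

lemma lbar_t [simp]: "lbar t = tinv"
  by (intro fls_eqI) (auto simp: lbar_nth)

lemma lbar_tinv [simp]: "lbar tinv = t"
  by (intro fls_eqI) (auto simp: lbar_nth)

text \<open>Evaluation at a unit \<open>u\<close> of the integers; as \<open>u\<^sup>-\<^sup>1 = u\<close>, the exponent \<open>n\<close> may be
  replaced by its absolute value.\<close>

definition eval_unit :: "int \<Rightarrow> lpoly \<Rightarrow> int" where
  "eval_unit u f = (\<Sum>n\<in>{n. fls_nth f n \<noteq> 0}. fls_nth f n * u ^ nat \<bar>n\<bar>)"

lemma eval1_eq: "eval1 = eval_unit 1"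
  by (auto simp: eval1_def eval_unit_def)

lemma eval_unit_superset:
  "finite S \<Longrightarrow> (\<And>n. n \<notin> S \<Longrightarrow> fls_nth f n = 0) \<Longrightarrow>
    eval_unit u f = (\<Sum>n\<in>S. fls_nth f n * u ^ nat \<bar>n\<bar>)"
  unfolding eval_unit_def by (rule sum.mono_neutral_left) auto

lemma eval_unit_lmono: "eval_unit u (lmono c n) = c * u ^ nat \<bar>n\<bar>"
  by (subst eval_unit_superset[of "{n}"]) auto

lemma eval_unit_add:
  assumes "laurent_poly f" "laurent_poly g"
  shows "eval_unit u (f + g) = eval_unit u f + eval_unit u g"
proof -
  let ?S = "{n. fls_nth f n \<noteq> 0} \<union> {n. fls_nth g n \<noteq> 0}"
  have fin: "finite ?S" using assms by (simp add: laurent_poly_def)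
  show ?thesis
    by (subst (1 2 3) eval_unit_superset[OF fin]) (auto simp: sum.distrib ring_distribs)
qed

lemma eval_unit_0 [simp]: "eval_unit u 0 = 0"
  by (simp add: eval_unit_def)

lemma eval_unit_uminus: "eval_unit u (- f) = - eval_unit u f"
  by (simp add: eval_unit_def sum_negf)

lemma eval_unit_diff:
  "laurent_poly f \<Longrightarrow> laurent_poly g \<Longrightarrow> eval_unit u (f - g) = eval_unit u f - eval_unit u g"
  using eval_unit_add[of f "- g"] by (simp add: eval_unit_uminus)

lemma eval_unit_sum:
  "(\<And>x. x \<in> S \<Longrightarrow> laurent_poly (f x)) \<Longrightarrow> eval_unit u (sum f S) = (\<Sum>x\<in>S. eval_unit u (f x))"
  by (induction S rule: infinite_finite_induct) (auto simp: eval_unit_add)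

lemma eval_unit_const [simp]: "eval_unit u (fls_const c) = c"
  by (subst eval_unit_superset[of "{0}"]) auto

lemma eval_unit_1 [simp]: "eval_unit u 1 = 1"
  by (subst eval_unit_superset[of "{0}"]) auto

lemma eval_unit_t [simp]: "eval_unit u t = u"
  by (subst eval_unit_superset[of "{1}"]) auto

lemma eval_unit_tinv [simp]: "eval_unit u tinv = u"
  by (subst eval_unit_superset[of "{-1}"]) auto

text \<open>The only units are 1 and -1, whose powers depend on the parity of the exponent alone,
  and absolute values preserve parity.\<close>

lemma unit_power_nat_abs_add:
  fixes u :: int assumes "\<bar>u\<bar> = 1"
  shows "u ^ nat \<bar>m + n\<bar> = u ^ nat \<bar>m\<bar> * u ^ nat \<bar>n\<bar>"
proof -
  have "u = 1 \<or> u = - 1" using assms by linarith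
  moreover have "even (nat \<bar>m + n\<bar>) \<longleftrightarrow> even (nat \<bar>m\<bar> + nat \<bar>n\<bar>)"
    by (simp add: even_nat_iff)
  ultimately show ?thesis
    by (auto simp: minus_one_power_iff power_add[symmetric])
qed

lemma eval_unit_mult:
  assumes "\<bar>u\<bar> = 1" "laurent_poly f" "laurent_poly g"
  shows "eval_unit u (f * g) = eval_unit u f * eval_unit u g"
  using assms(2)
proof (induction f rule: laurent_poly_induct)
  case (mono c m)
  show ?case using assms(3)
    by (induction g rule: laurent_poly_induct)
       (auto simp: lmono_mult eval_unit_lmono eval_unit_add ring_distribs
                   unit_power_nat_abs_add[OF assms(1)])
qed (use assms(3) in \<open>auto simp: eval_unit_add ring_distribs\<close>)

subsection \<open>Polynomials given by coefficient lists\<close>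

text \<open>Horner form. Identities between explicit polynomials become computations with integer
  lists, which the simplifier can carry out.\<close>

fun lp :: "int list \<Rightarrow> lpoly" where
  "lp [] = 0"
| "lp (c # cs) = fls_const c + t * lp cs"

fun ladd :: "int list \<Rightarrow> int list \<Rightarrow> int list" where
  "ladd [] ys = ys"
| "ladd xs [] = xs"
| "ladd (x # xs) (y # ys) = (x + y) # ladd xs ys"

fun lmul :: "int list \<Rightarrow> int list \<Rightarrow> int list" where
  "lmul [] ys = []"
| "lmul (x # xs) ys = ladd (map ((*) x) ys) (0 # lmul xs ys)"

lemma laurent_poly_lp [simp]: "laurent_poly (lp cs)"
  by (induction cs) auto

lemma lp_add: "lp xs + lp ys = lp (ladd xs ys)"
proof (induction xs ys rule: ladd.induct)
  case (3 x xs y ys)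
  have "lp (x # xs) + lp (y # ys) = fls_const (x + y) + t * (lp xs + lp ys)"
    by (simp add: algebra_simps fls_plus_const[symmetric] del: fls_plus_const)
  then show ?case by (simp add: 3)
qed simp_all

lemma lp_map: "lp (map ((*) c) ys) = fls_const c * lp ys"
  by (induction ys) (auto simp: algebra_simps fls_const_mult_const[symmetric] simp del: fls_const_mult_const)

lemma lp_mult: "lp xs * lp ys = lp (lmul xs ys)"
  by (induction xs) (auto simp: lp_add[symmetric] lp_map algebra_simps)

lemma lp_diff: "lp xs - lp ys = lp (ladd xs (map ((*) (- 1)) ys))"
  by (simp add: lp_add[symmetric] lp_map)

lemma lp_append: "lp (xs @ ys) = lp xs + t ^ length xs * lp ys"
  by (induction xs) (auto simp: algebra_simps)

lemma t_tinv [simp]: "t * tinv = 1" "tinv * t = 1"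
  by (simp_all add: fls_X_inv_conv_shift_1 fls_X_conv_shift_1 fls_shifted_times_simps)

text \<open>Replacing t by its inverse reverses the coefficients; n is the top exponent, one less
  than the length, and the factor \<open>tinv ^ n\<close> moves the reversed list back.\<close>

lemma lbar_lp: "length cs = Suc n \<Longrightarrow> lbar (lp cs) = tinv ^ n * lp (rev cs)"
proof (induction cs arbitrary: n)
  case (Cons c cs)
  show ?case
  proof (cases n)
    case 0
    then show ?thesis using Cons by (auto simp: lbar_add lbar_mult)
  next
    case (Suc m)
    have "tinv ^ n * (t ^ n * fls_const c) = fls_const c"
      by (simp add: mult.assoc[symmetric] power_mult_distrib[symmetric])
    moreover have "lbar (lp cs) = tinv ^ m * lp (rev cs)" using Cons Suc by auto
    ultimately show ?thesis using Cons.prems Suc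
      by (simp add: lbar_add lbar_mult lp_append algebra_simps)
  qed
qed simp

lemma eval_unit_lp_Cons: "\<bar>u\<bar> = 1 \<Longrightarrow> eval_unit u (lp (c # cs)) = c + u * eval_unit u (lp cs)"
  by (simp add: eval_unit_add eval_unit_mult)

subsection \<open>Salter's group is a monoid\<close>

lemma mat3_nth [simp]:
  "mat3 [[a, b, c], [d, e, f], [g, h, i]] $ 1 $ 1 = a"
  "mat3 [[a, b, c], [d, e, f], [g, h, i]] $ 1 $ 2 = b"
  "mat3 [[a, b, c], [d, e, f], [g, h, i]] $ 1 $ 3 = c"
  "mat3 [[a, b, c], [d, e, f], [g, h, i]] $ 2 $ 1 = d"
  "mat3 [[a, b, c], [d, e, f], [g, h, i]] $ 2 $ 2 = e"
  "mat3 [[a, b, c], [d, e, f], [g, h, i]] $ 2 $ 3 = f"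
  "mat3 [[a, b, c], [d, e, f], [g, h, i]] $ 3 $ 1 = g"
  "mat3 [[a, b, c], [d, e, f], [g, h, i]] $ 3 $ 2 = h"
  "mat3 [[a, b, c], [d, e, f], [g, h, i]] $ 3 $ 3 = i"
  by (simp_all add: mat3_def idx3_def)

lemma vec3_nth [simp]:
  "vec3 [a, b, c] $ 1 = a" "vec3 [a, b, c] $ 2 = b" "vec3 [a, b, c] $ 3 = c"
  by (simp_all add: vec3_def idx3_def)

lemma mat3_mult:
  "mat3 [[a, b, c], [d, e, f], [g, h, i]] ** mat3 [[a', b', c'], [d', e', f'], [g', h', i']] =
   mat3 [[a * a' + b * d' + c * g', a * b' + b * e' + c * h', a * c' + b * f' + c * i'],
         [d * a' + e * d' + f * g', d * b' + e * e' + f * h', d * c' + e * f' + f * i'],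
         [g * a' + h * d' + i * g', g * b' + h * e' + i * h', g * c' + h * f' + i * i']]"
  by (simp add: vec_eq_iff forall_3 matrix_matrix_mult_def sum_3)

lemma mat3_transpose:
  "transpose (mat3 [[a, b, c], [d, e, f], [g, h, i]]) = mat3 [[a, d, g], [b, e, h], [c, f, i]]"
  by (simp add: vec_eq_iff forall_3 transpose_def)

lemma mat3_mbar:
  "mbar (mat3 [[a, b, c], [d, e, f], [g, h, i]]) =
   mat3 [[lbar a, lbar b, lbar c], [lbar d, lbar e, lbar f], [lbar g, lbar h, lbar i]]"
  by (simp add: vec_eq_iff forall_3 mbar_def)

lemma mat3_one: "mat 1 = mat3 [[1, 0, 0], [0, 1, 0], [0, 0, 1]]"
  by (simp add: vec_eq_iff forall_3 mat_def)

lemma laurent_mat_mat3: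
  "laurent_mat (mat3 [[a, b, c], [d, e, f], [g, h, i]]) \<longleftrightarrow>
   (\<forall>x \<in> {a, b, c, d, e, f, g, h, i}. laurent_poly x)"
  by (auto simp: laurent_mat_def forall_3)

lemma laurent_mat_mult: "laurent_mat A \<Longrightarrow> laurent_mat B \<Longrightarrow> laurent_mat (A ** B)"
  by (simp add: laurent_mat_def matrix_matrix_mult_def)

lemma laurent_mat_one [simp]: "laurent_mat (mat 1)"
  by (simp add: laurent_mat_def mat_def)

lemma mbar_mult:
  "laurent_mat A \<Longrightarrow> laurent_mat B \<Longrightarrow> mbar (A ** B) = mbar A ** mbar B"
  by (simp add: mbar_def vec_eq_iff laurent_mat_def matrix_matrix_mult_def lbar_sum lbar_mult)

lemma GL3_mult:
  assumes "A \<in> GL3" "B \<in> GL3" shows "A ** B \<in> GL3"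
proof -
  obtain A' B' where A': "laurent_mat A'" "A ** A' = mat 1" "A' ** A = mat 1"
    and B': "laurent_mat B'" "B ** B' = mat 1" "B' ** B = mat 1"
    using assms by (auto simp: GL3_def)
  have "(A ** B) ** (B' ** A') = mat 1" "(B' ** A') ** (A ** B) = mat 1"
    using A' B' by (metis matrix_mul_assoc matrix_mul_rid)+
  then show ?thesis
    using assms A'(1) B'(1) laurent_mat_mult unfolding GL3_def by blast
qed

lemma is_perm_matrix_mult:
  assumes "is_perm_matrix P" "is_perm_matrix Q" shows "is_perm_matrix (P ** Q)"
proof -
  obtain p q where p: "p permutes UNIV" "\<And>i j. P $ i $ j = (if p i = j then 1 else 0)"
    and q: "q permutes UNIV" "\<And>i j. Q $ i $ j = (if q i = j then 1 else 0)"
    using assms by (auto simp: is_perm_matrix_def)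
  have "(P ** Q) $ i $ j = (if (q \<circ> p) i = j then 1 else 0)" for i j
    by (simp add: matrix_matrix_mult_def p q if_distrib[of "\<lambda>x. x * _"] cong: if_cong)
  moreover have "(q \<circ> p) permutes UNIV" using p(1) q(1) by (rule permutes_compose)
  ultimately show ?thesis unfolding is_perm_matrix_def by blast
qed

lemma eval1_mat_mult:
  "laurent_mat A \<Longrightarrow> laurent_mat B \<Longrightarrow>
   (\<chi> i j. eval1 ((A ** B) $ i $ j)) = (\<chi> i j. eval1 (A $ i $ j)) ** (\<chi> i j. eval1 (B $ i $ j))"
  by (simp add: vec_eq_iff laurent_mat_def matrix_matrix_mult_def eval1_eq eval_unit_sum eval_unit_mult)

lemma Gamma_laurent: "A \<in> Gamma \<Longrightarrow> laurent_mat A"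
  by (simp add: Gamma_def GL3_def)

lemma Gamma_mult:
  assumes "A \<in> Gamma" "B \<in> Gamma" shows "A ** B \<in> Gamma"
proof -
  have "mbar (A ** B) ** J3 ** transpose (A ** B) =
    mbar A ** (mbar B ** J3 ** transpose B) ** transpose A"
    by (simp add: mbar_mult assms[THEN Gamma_laurent] matrix_transpose_mul matrix_mul_assoc)
  then show ?thesis
    using assms GL3_mult is_perm_matrix_mult
    by (auto simp: Gamma_def eval1_mat_mult GL3_def
        matrix_vector_mul_assoc[symmetric] vector_matrix_mul_assoc[symmetric])
qed

lemma Gamma_one: "mat 1 \<in> Gamma"
proof -
  have "mbar (mat 1) = mat 1" by (simp add: mat3_one mat3_mbar)
  moreover have "is_perm_matrix (\<chi> i j. eval1 ((mat 1 :: lmat) $ i $ j))"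
    unfolding is_perm_matrix_def by (rule exI[of _ id]) (auto simp: mat_def eval1_eq permutes_id)
  moreover have "transpose (mat 1 :: lmat) = mat 1" by (rule transpose_mat)
  moreover have "(mat 1 :: lmat) \<in> GL3" unfolding GL3_def by (auto intro!: exI[of _ "mat 1"])
  ultimately show ?thesis by (simp add: Gamma_def)
qed

lemma monoid_Gamma: "monoid Gamma_grp"
  by unfold_locales (auto simp: Gamma_grp_def Gamma_mult Gamma_one matrix_mul_assoc)

text \<open>Since \<open>transpose B\<close> is inverse to \<open>transpose A\<close>, unitarity can
  be checked with one product on each side instead of a triple product, which keeps the check of a
  large explicit matrix small.\<close>

lemma GammaI:
  assumes "laurent_mat A" "laurent_mat B" "A ** B = mat 1" "B ** A = mat 1"
    and "vrow v* A = vrow" "A *v ones3 = ones3"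
    and unitary: "mbar A ** J3 = J3 ** transpose B"
    and "is_perm_matrix (\<chi> i j. eval1 (A $ i $ j))"
  shows "A \<in> Gamma"
proof -
  have "transpose B ** transpose A = mat 1"
    using assms(3) by (metis matrix_transpose_mul transpose_mat)
  then have "mbar A ** J3 ** transpose A = J3"
    unfolding unitary by (simp add: matrix_mul_assoc[symmetric])
  then show ?thesis using assms by (auto simp: Gamma_def GL3_def)
qed

text \<open>The case a = b is allowed and yields the identity permutation.\<close>

lemma is_perm_matrix_swap:
  fixes P :: "int ^ 3 ^ 3"
  assumes "\<forall>i j. P $ i $ j = (if Transposition.transpose a b i = j then 1 else 0)"
  shows "is_perm_matrix P"
  unfolding is_perm_matrix_def using assms
  by (intro exI[of _ "Transposition.transpose a b"]) (auto intro: permutes_swap_id)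

subsection \<open>The Burau generators\<close>

definition burau_s1_inv :: lmat where
  "burau_s1_inv = mat3 [[0, 1, 0], [tinv, 1 - tinv, 0], [0, 0, 1]]"

definition burau_s2_inv :: lmat where
  "burau_s2_inv = mat3 [[1, 0, 0], [0, 0, 1], [0, tinv, 1 - tinv]]"

lemma t_tinv_assoc [simp]: "t * (tinv * x) = x" "tinv * (t * x) = x"
  by (simp_all add: mult.assoc[symmetric])

lemma burau_inverse:
  "burau_s1 ** burau_s1_inv = mat 1" "burau_s1_inv ** burau_s1 = mat 1"
  "burau_s2 ** burau_s2_inv = mat 1" "burau_s2_inv ** burau_s2 = mat 1"
  by (simp_all add: burau_s1_def burau_s1_inv_def burau_s2_def burau_s2_inv_def mat3_mult mat3_one
      algebra_simps)

lemmas mat3_simps =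
  laurent_mat_mat3 mat3_mult mat3_one mat3_mbar mat3_transpose J3_def vrow_def ones3_def
  vec_eq_iff forall_3 matrix_vector_mult_def vector_matrix_mult_def sum_3
  lbar_add lbar_mult algebra_simps power2_eq_square power3_eq_cube

lemma burau_in_Gamma:
  "burau_s1 \<in> Gamma" "burau_s1_inv \<in> Gamma" "burau_s2 \<in> Gamma" "burau_s2_inv \<in> Gamma"
proof -
  show "burau_s1 \<in> Gamma"
    by (rule GammaI[OF _ _ burau_inverse(1,2) _ _ _ is_perm_matrix_swap[of _ 1 2]])
       (simp_all add: burau_s1_def burau_s1_inv_def mat3_simps
         lbar_diff eval1_eq eval_unit_diff Transposition.transpose_def)
  show "burau_s1_inv \<in> Gamma"
    by (rule GammaI[OF _ _ burau_inverse(2,1) _ _ _ is_perm_matrix_swap[of _ 1 2]])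
       (simp_all add: burau_s1_def burau_s1_inv_def mat3_simps
         lbar_diff eval1_eq eval_unit_diff Transposition.transpose_def)
  show "burau_s2 \<in> Gamma"
    by (rule GammaI[OF _ _ burau_inverse(3,4) _ _ _ is_perm_matrix_swap[of _ 2 3]])
       (simp_all add: burau_s2_def burau_s2_inv_def mat3_simps
         lbar_diff eval1_eq eval_unit_diff Transposition.transpose_def)
  show "burau_s2_inv \<in> Gamma"
    by (rule GammaI[OF _ _ burau_inverse(4,3) _ _ _ is_perm_matrix_swap[of _ 2 3]])
       (simp_all add: burau_s2_def burau_s2_inv_def mat3_simps
         lbar_diff eval1_eq eval_unit_diff Transposition.transpose_def)
qed

subsection \<open>An element of Salter's group outside the Burau image\<close>

text \<open>One common shift n serves all entries of a matrix, so that shifts simply add under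
  matrix products.\<close>

definition ltl :: "nat \<Rightarrow> int list \<Rightarrow> lpoly" where
  "ltl n cs = tinv ^ n * lp cs"

definition ltl_mat :: "nat \<Rightarrow> int list list list \<Rightarrow> lmat" where
  "ltl_mat n rs = mat3 (map (map (ltl n)) rs)"

lemma laurent_poly_ltl [simp]: "laurent_poly (ltl n cs)"
  by (simp add: ltl_def)

lemma ltl_mult: "ltl m xs * ltl n ys = ltl (m + n) (lmul xs ys)"
  by (simp add: ltl_def lp_mult[symmetric] power_add algebra_simps)

lemma ltl_add: "ltl n xs + ltl n ys = ltl n (ladd xs ys)"
  by (simp add: ltl_def lp_add[symmetric] algebra_simps)

lemma lbar_ltl_0: "length cs = Suc n \<Longrightarrow> lbar (ltl 0 cs) = ltl n (rev cs)"
  by (simp add: ltl_def lbar_lp)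

lemma ltl_one: "ltl n (replicate n 0 @ [1]) = 1"
proof -
  have "lp (replicate n 0) = 0" by (induction n) auto
  then show ?thesis
    by (simp add: ltl_def lp_append power_mult_distrib[symmetric])
qed

lemma ltl_zero: "ltl n [] = 0"
  by (simp add: ltl_def)

lemma mat_one_ltl: "mat 1 = ltl_mat n
   [[replicate n 0 @ [1], [], []], [[], replicate n 0 @ [1], []], [[], [], replicate n 0 @ [1]]]"
  by (simp add: ltl_mat_def mat3_one ltl_one ltl_zero)

lemma J3_ltl: "J3 = ltl_mat 1
   [[[0, 1], [- 1], [- 1]], [[0, 0, - 1], [0, 1], [- 1]], [[0, 0, - 1], [0, 0, - 1], [0, 1]]]"
proof -
  have "fls_const (- 1) = (- 1 :: lpoly)" by (intro fls_eqI) simp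
  then show ?thesis by (simp add: ltl_mat_def J3_def ltl_def)
qed

text \<open>Found by computer. In the reduced representation, \<open>SU(2)\<close> over \<open>\<int>[t, t\<^sup>-\<^sup>1]\<close> is the norm-one
  group of a quaternion order over \<open>\<int>[s]\<close>, \<open>s = t + t\<^sup>-\<^sup>1\<close>, whose norm form is positive definite on
  \<open>-1 < s < 2\<close>. Hence the elements of bounded degree are short vectors of a lattice; the least degree
  for which they do not all lie in the Burau image yields this matrix, up to Burau matrices and units.\<close>

definition witness_list :: "int list list list" where
  "witness_list =
    [[[1, - 1, 1, - 1, 1, - 2, 3, - 3, 2, 0, - 2, 3, - 2, 1],
      [0, 1, - 3, 5, - 7, 10, - 14, 18, - 20, 19, - 15, 9, - 4, 1],
      [0, 0, 2, - 4, 6, - 8, 11, - 15, 18, - 19, 17, - 12, 6, - 2]],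
     [[1, - 2, 2, - 1, 0, 0, 1, - 2, 2, - 1, - 1, 2, - 2, 1],
      [0, 3, - 6, 8, - 8, 8, - 9, 11, - 13, 14, - 12, 8, - 4, 1],
      [0, - 1, 4, - 7, 8, - 8, 8, - 9, 11, - 13, 13, - 10, 6, - 2]],
     [[1, - 1, 0, 2, - 3, 2, 0, - 2, 3, - 2, 0, 1, - 1, 0],
      [0, 1, - 1, - 2, 6, - 9, 9, - 6, 1, 3, - 4, 3, - 1, 0],
      [0, 0, 1, 0, - 3, 7, - 9, 8, - 4, - 1, 4, - 4, 2, 0]]]"

text \<open>Unitarity determines the inverse: its transpose is J3^-1 times the bar of the witness
  times J3. The entries have exponents from -13 to 0, where 13 is the degree of the witness.\<close>

definition witness_inv_list :: "int list list list" where
  "witness_inv_list =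
    [[[0, 1, - 2, 3, - 2, 0, 2, - 3, 3, - 2, 1, - 1, 1, 0],
      [0, 0, 1, - 3, 4, - 3, 0, 3, - 5, 5, - 3, 1, 0, 0],
      [0, - 1, 1, 0, - 2, 3, - 2, 0, 2, - 3, 2, 0, - 1, 1]],
     [[- 1, 4, - 9, 14, - 17, 17, - 15, 12, - 9, 7, - 5, 3, - 1, 0],
      [0, - 1, 5, - 12, 19, - 23, 23, - 19, 13, - 8, 5, - 3, 2, 0],
      [1, - 3, 4, - 2, - 2, 6, - 8, 7, - 4, 1, 0, 0, - 1, 1]],
     [[- 2, 6, - 12, 17, - 19, 18, - 15, 11, - 8, 6, - 4, 2, 0, 0],
      [0, - 2, 8, - 16, 23, - 26, 24, - 18, 11, - 6, 3, - 2, 1, 0],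
      [2, - 4, 4, - 1, - 4, 8, - 9, 7, - 3, 0, 1, 0, - 1, 1]]]"

definition witness :: lmat where
  "witness = ltl_mat 0 witness_list"

definition witness_inv :: lmat where
  "witness_inv = ltl_mat 13 witness_inv_list"

text \<open>\<open>ladd\<close> and \<open>lmul\<close> leave trailing zeros in place, so lists are
  compared up to padding.\<close>

fun leq_pad :: "int list \<Rightarrow> int list \<Rightarrow> bool" where
  "leq_pad [] ys = list_all (\<lambda>y. y = 0) ys"
| "leq_pad xs [] = list_all (\<lambda>x. x = 0) xs"
| "leq_pad (x # xs) (y # ys) \<longleftrightarrow> x = y \<and> leq_pad xs ys"

lemma lp_zeros: "list_all (\<lambda>x. x = 0) xs \<Longrightarrow> lp xs = 0"
  by (induction xs) auto

lemma ltl_cong: "leq_pad xs ys \<Longrightarrow> ltl n xs = ltl n ys"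
proof -
  assume "leq_pad xs ys"
  then have "lp xs = lp ys"
    by (induction xs ys rule: leq_pad.induct) (auto simp: lp_zeros)
  then show ?thesis by (simp add: ltl_def)
qed

lemma ltl_mat_mult:
  "ltl_mat m [[a, b, c], [d, e, f], [g, h, i]] ** ltl_mat n [[a', b', c'], [d', e', f'], [g', h', i']] =
   (let dot = (\<lambda>x y z x' y' z'. ladd (ladd (lmul x x') (lmul y y')) (lmul z z')) in
    ltl_mat (m + n)
     [[dot a b c a' d' g', dot a b c b' e' h', dot a b c c' f' i'],
      [dot d e f a' d' g', dot d e f b' e' h', dot d e f c' f' i'],
      [dot g h i a' d' g', dot g h i b' e' h', dot g h i c' f' i']])"
  by (simp add: ltl_mat_def mat3_mult ltl_mult ltl_add Let_def)

lemma ltl_mat_cong: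
  "list_all2 (list_all2 leq_pad) xs ys \<Longrightarrow> ltl_mat n xs = ltl_mat n ys"
proof -
  assume "list_all2 (list_all2 leq_pad) xs ys"
  then have "map (map (ltl n)) xs = map (map (ltl n)) ys"
    by (auto simp: list_all2_conv_all_nth ltl_cong intro!: nth_equalityI)
  then show ?thesis by (simp add: ltl_mat_def)
qed

lemma witness_inverse: "witness ** witness_inv = mat 1" "witness_inv ** witness = mat 1"
  unfolding witness_def witness_inv_def witness_list_def witness_inv_list_def
    ltl_mat_mult Let_def mat_one_ltl[of 13]
  by (simp, rule ltl_mat_cong, simp add: numeral_eq_Suc)+

lemma witness_unitary: "mbar witness ** J3 = J3 ** transpose witness_inv"
proof -
  have "mbar witness = ltl_mat 13 (map (map rev) witness_list)"
    by (simp add: witness_def witness_list_def ltl_mat_def mat3_mbar lbar_ltl_0[where n = 13])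
  moreover have "transpose witness_inv = ltl_mat 13 (map (\<lambda>j. map (\<lambda>r. r ! j) witness_inv_list) [0, 1, 2])"
    by (simp add: witness_inv_def witness_inv_list_def ltl_mat_def mat3_transpose)
  ultimately show ?thesis
    unfolding J3_ltl witness_list_def witness_inv_list_def
    by (simp add: ltl_mat_mult Let_def) (rule ltl_mat_cong, simp)
qed

lemma witness_fixes: "vrow v* witness = vrow" "witness *v ones3 = ones3"
proof -
  have v: "vrow = vec3 [ltl 0 [0, 1], ltl 0 [0, 0, 1], ltl 0 [0, 0, 0, 1]]"
    by (simp add: vrow_def ltl_def power2_eq_square power3_eq_cube mult.assoc)
  show "vrow v* witness = vrow"
    unfolding v witness_def witness_list_def
    by (simp add: ltl_mat_def vec_eq_iff forall_3 vector_matrix_mult_def sum_3 ltl_mult ltl_add)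
       (intro conjI ltl_cong; simp)
  have o: "ones3 = vec3 [ltl 0 [1], ltl 0 [1], ltl 0 [1]]"
    by (simp add: ones3_def ltl_def)
  show "witness *v ones3 = ones3"
    unfolding o witness_def witness_list_def
    by (simp add: ltl_mat_def vec_eq_iff forall_3 matrix_vector_mult_def sum_3 ltl_mult ltl_add)
       (intro conjI ltl_cong; simp)
qed

lemma eval_unit_ltl_0_Cons:
  "\<bar>u\<bar> = 1 \<Longrightarrow> eval_unit u (ltl 0 (c # cs)) = c + u * eval_unit u (ltl 0 cs)"
  "eval_unit u (ltl 0 []) = 0"
  by (simp_all add: ltl_def eval_unit_lp_Cons[unfolded lp.simps])

lemma witness_in_Gamma: "witness \<in> Gamma"
proof (rule GammaI[OF _ _ witness_inverse witness_fixes witness_unitary])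
  show "laurent_mat witness" "laurent_mat witness_inv"
    by (simp_all add: witness_def witness_inv_def witness_list_def witness_inv_list_def
        ltl_mat_def laurent_mat_mat3)
  show "is_perm_matrix (\<chi> i j. eval1 (witness $ i $ j))"
    by (rule is_perm_matrix_swap[of _ 1 1])
       (simp add: forall_3 witness_def witness_list_def ltl_mat_def eval1_eq eval_unit_ltl_0_Cons)
qed

subsection \<open>The reduced representation and its specialisation at -1\<close>

definition mat2 :: "'a \<Rightarrow> 'a \<Rightarrow> 'a \<Rightarrow> 'a \<Rightarrow> 'a ^ 2 ^ 2" where
  "mat2 a b c d = (\<chi> i j. if i = 1 then (if j = 1 then a else b) else (if j = 1 then c else d))"

lemma mat2_nth [simp]:
  "mat2 a b c d $ 1 $ 1 = a" "mat2 a b c d $ 1 $ 2 = b"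
  "mat2 a b c d $ 2 $ 1 = c" "mat2 a b c d $ 2 $ 2 = d"
  by (simp_all add: mat2_def)

lemma mat2_mult:
  "mat2 a b c d ** mat2 a' b' c' d' =
   mat2 (a * a' + b * c') (a * b' + b * d') (c * a' + d * c') (c * b' + d * d')"
  by (simp add: vec_eq_iff forall_2 matrix_matrix_mult_def sum_2)

lemma mat2_eq_iff [simp]:
  "mat2 a b c d = mat2 a' b' c' d' \<longleftrightarrow> a = a' \<and> b = b' \<and> c = c' \<and> d = d'"
  by (auto simp: vec_eq_iff forall_2)

lemma mat2_cases:
  obtains a b c d where "M = mat2 a b c d"
proof
  show "M = mat2 (M $ 1 $ 1) (M $ 1 $ 2) (M $ 2 $ 1) (M $ 2 $ 2)"
    by (simp add: vec_eq_iff forall_2)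
qed

text \<open>A domain on which \<open>red\<close> is multiplicative. It contains the inverses of
  elements of \<open>Gamma\<close> at once, without a proof that \<open>Gamma\<close> is closed
  under inversion.\<close>

definition fixes_ones :: "lmat set" where
  "fixes_ones = {A. laurent_mat A \<and> A *v ones3 = ones3}"

lemma Gamma_fixes_ones: "A \<in> Gamma \<Longrightarrow> A \<in> fixes_ones"
  by (simp add: fixes_ones_def Gamma_laurent) (simp add: Gamma_def)

text \<open>The action on the quotient by the fixed vector, in the coordinates
  \<open>x\<^sub>1 - x\<^sub>2\<close>, \<open>x\<^sub>2 - x\<^sub>3\<close>.\<close>

definition red :: "lmat \<Rightarrow> lpoly ^ 2 ^ 2" where
  "red A = mat2 (A $ 1 $ 1 - A $ 2 $ 1) (A $ 2 $ 3 - A $ 1 $ 3)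
                (A $ 2 $ 1 - A $ 3 $ 1) (A $ 3 $ 3 - A $ 2 $ 3)"

text \<open>The rows of A sum to 1, so each row of \<open>A ** B\<close> is row 2 of B plus a
  combination of differences of neighbouring rows of B; the differences of rows then multiply as 2
  by 2 matrices.\<close>

lemma red_mult:
  assumes "A \<in> fixes_ones" shows "red (A ** B) = red A ** red B"
proof -
  have "A $ i $ 1 + A $ i $ 2 + A $ i $ 3 = 1" for i
  proof -
    have "(A *v ones3) $ i = ones3 $ i" using assms by (simp add: fixes_ones_def)
    then show ?thesis
      using exhaust_3[of i] by (auto simp: matrix_vector_mult_def sum_3 ones3_def)
  qed
  then have row: "A $ i $ 2 = 1 - A $ i $ 1 - A $ i $ 3" for i
    by (simp add: algebra_simps)
  show ?thesis
    unfolding red_def mat2_mult mat2_eq_iff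
    by (simp add: matrix_matrix_mult_def sum_3 row algebra_simps)
qed

lemma red_one: "red (mat 1) = mat2 1 0 0 1"
  by (simp add: red_def mat3_one)

lemma laurent_poly_red: "laurent_mat A \<Longrightarrow> laurent_poly (red A $ i $ j)"
  by (simp add: red_def mat2_def laurent_mat_def)

definition red_at_m1 :: "lmat \<Rightarrow> int ^ 2 ^ 2" where
  "red_at_m1 A = (\<chi> i j. eval_unit (- 1) (red A $ i $ j))"

lemma red_at_m1_mat2:
  "red A = mat2 p q r s \<Longrightarrow> red_at_m1 A =
    mat2 (eval_unit (- 1) p) (eval_unit (- 1) q) (eval_unit (- 1) r) (eval_unit (- 1) s)"
  by (simp add: red_at_m1_def vec_eq_iff forall_2)

lemma red_at_m1_mult:
  assumes "A \<in> fixes_ones" "B \<in> fixes_ones"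
  shows "red_at_m1 (A ** B) = red_at_m1 A ** red_at_m1 B"
proof -
  have "laurent_mat A" "laurent_mat B" using assms by (auto simp: fixes_ones_def)
  note l = this[THEN laurent_poly_red]
  show ?thesis
    unfolding red_at_m1_def red_mult[OF assms(1)]
    by (simp add: vec_eq_iff matrix_matrix_mult_def eval_unit_sum eval_unit_mult l)
qed

lemma red_at_m1_Gamma_mult:
  "A \<in> Gamma \<Longrightarrow> B \<in> Gamma \<Longrightarrow> red_at_m1 (A ** B) = red_at_m1 A ** red_at_m1 B"
  by (intro red_at_m1_mult Gamma_fixes_ones)

lemma red_at_m1_one: "red_at_m1 (mat 1) = mat2 1 0 0 1"
  using red_at_m1_mat2[OF red_one] by simp

lemma red_burau:
  "red burau_s1 = mat2 (- t) 0 1 1" "red burau_s1_inv = mat2 (- tinv) 0 tinv 1"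
  "red burau_s2 = mat2 1 t 0 (- t)" "red burau_s2_inv = mat2 1 1 0 (- tinv)"
  by (simp_all add: red_def burau_s1_def burau_s1_inv_def burau_s2_def burau_s2_inv_def)

lemma red_at_m1_burau:
  "red_at_m1 burau_s1 = mat2 1 0 1 1" "red_at_m1 burau_s1_inv = mat2 1 0 (- 1) 1"
  "red_at_m1 burau_s2 = mat2 1 (- 1) 0 1" "red_at_m1 burau_s2_inv = mat2 1 1 0 1"
  by (simp_all add: red_burau[THEN red_at_m1_mat2] eval_unit_uminus)

subsection \<open>Elements commuting with the Burau image\<close>

text \<open>A substitute for the centre of \<open>Gamma\<close> that contains it and for which
  membership is two matrix identities.\<close>

definition burau_commutant :: "lmat set" where
  "burau_commutant = {z \<in> Gamma. z ** burau_s1 = burau_s1 ** z \<and> z ** burau_s2 = burau_s2 ** z}"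

lemma burau_commutant_mult:
  "y \<in> burau_commutant \<Longrightarrow> z \<in> burau_commutant \<Longrightarrow> y ** z \<in> burau_commutant"
  by (auto simp: burau_commutant_def Gamma_mult) (metis matrix_mul_assoc)+

lemma burau_commutant_one: "mat 1 \<in> burau_commutant"
  by (simp add: burau_commutant_def Gamma_one)

lemma Gamma_inverse:
  assumes "A \<in> Gamma"
  obtains B where "B \<in> fixes_ones" "A ** B = mat 1" "B ** A = mat 1"
proof -
  obtain B where B: "laurent_mat B" "A ** B = mat 1" "B ** A = mat 1" and "A *v ones3 = ones3"
    using assms by (auto simp: Gamma_def GL3_def)
  then have "B *v ones3 = ones3"
    by (metis matrix_vector_mul_assoc matrix_vector_mul_lid)
  then show thesis using that B by (auto simp: fixes_ones_def)
qed

text \<open>At -1 the generators are a lower and an upper elementary matrix; commuting with both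
  forces a scalar, and invertibility over the integers makes it a unit.\<close>

lemma red_at_m1_commutant:
  assumes "z \<in> burau_commutant"
  obtains l where "l = 1 \<or> l = - 1" "red_at_m1 z = mat2 l 0 0 l"
proof -
  have z: "z \<in> Gamma" "z ** burau_s1 = burau_s1 ** z" "z ** burau_s2 = burau_s2 ** z"
    using assms by (auto simp: burau_commutant_def)
  obtain a b c d where abcd: "red_at_m1 z = mat2 a b c d" by (rule mat2_cases)
  have "red_at_m1 z ** red_at_m1 burau_s1 = red_at_m1 burau_s1 ** red_at_m1 z"
    "red_at_m1 z ** red_at_m1 burau_s2 = red_at_m1 burau_s2 ** red_at_m1 z"
    using z by (metis red_at_m1_Gamma_mult burau_in_Gamma(1,3))+
  then have s: "red_at_m1 z = mat2 a 0 0 a"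
    by (simp add: abcd red_at_m1_burau mat2_mult)
  obtain B where B: "B \<in> fixes_ones" "z ** B = mat 1" using Gamma_inverse[OF z(1)] by blast
  obtain a' b' c' d' where B': "red_at_m1 B = mat2 a' b' c' d'" by (rule mat2_cases)
  have "red_at_m1 z ** red_at_m1 B = mat2 1 0 0 1"
    using red_at_m1_mult[OF Gamma_fixes_ones[OF z(1)] B(1)] B(2) by (simp add: red_at_m1_one)
  then have "a * a' = 1" by (simp add: s B' mat2_mult)
  then have "a = 1 \<or> a = - 1" using zmult_eq_1_iff by blast
  then show thesis using that s by blast
qed

subsection \<open>A normal form in the Burau image\<close>

text \<open>\<open>x\<close> and \<open>y\<close> are the generators of orders 2 and 3 of the quotient of the braid group by its centre;
  \<open>c\<close> is the full twist.\<close>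

definition braid_x :: lmat where "braid_x = burau_s1 ** burau_s2 ** burau_s1"
definition braid_y :: lmat where "braid_y = burau_s1 ** burau_s2"
definition full_twist :: lmat where "full_twist = braid_x ** braid_x"
definition full_twist_inv :: lmat where
  "full_twist_inv = burau_s1_inv ** burau_s2_inv ** burau_s1_inv ** burau_s1_inv ** burau_s2_inv ** burau_s1_inv"

lemma braid_xy_Gamma: "braid_x \<in> Gamma" "braid_y \<in> Gamma"
  by (simp_all add: braid_x_def braid_y_def Gamma_mult burau_in_Gamma)

text \<open>Both x^2 and y^3 are the full twist. Multiplied by it, each generator and each inverse
  generator becomes a positive word in x and y, so inverses disappear modulo the full twist.\<close>

lemma burau_relations:
  "braid_y ** braid_y ** braid_y = full_twist"
  "burau_s1 ** full_twist = braid_y ** braid_y ** braid_x"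
  "burau_s2 ** full_twist = braid_x ** braid_y ** braid_y"
  "burau_s1_inv ** full_twist = braid_x ** braid_y" "burau_s2_inv ** full_twist = braid_y ** braid_x"
  "full_twist ** burau_s1 = burau_s1 ** full_twist" "full_twist ** burau_s2 = burau_s2 ** full_twist"
  by (simp_all add: braid_x_def braid_y_def full_twist_def burau_s1_def burau_s2_def burau_s1_inv_def burau_s2_inv_def
      mat3_mult algebra_simps)

lemma full_twist_inverse: "full_twist ** full_twist_inv = mat 1" "full_twist_inv ** full_twist = mat 1"
  by (simp_all add: braid_x_def full_twist_def full_twist_inv_def burau_s1_def burau_s2_def burau_s1_inv_def
      burau_s2_inv_def mat3_mult mat3_one algebra_simps)

lemma full_twist_commutant: "full_twist \<in> burau_commutant" "full_twist_inv \<in> burau_commutant"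
proof -
  show full_twist: "full_twist \<in> burau_commutant"
    by (simp add: burau_commutant_def burau_relations full_twist_def[symmetric])
       (simp add: full_twist_def Gamma_mult braid_xy_Gamma)
  have "full_twist_inv ** s = s ** full_twist_inv" if "full_twist ** s = s ** full_twist" for s
    using that full_twist_inverse by (metis matrix_mul_assoc matrix_mul_lid matrix_mul_rid)
  then show "full_twist_inv \<in> burau_commutant"
    by (simp add: burau_commutant_def burau_relations)
       (simp add: full_twist_inv_def Gamma_mult burau_in_Gamma)
qed

lemma matrix_commute_mult:
  "z ** a = a ** z \<Longrightarrow> z ** b = b ** z \<Longrightarrow> z ** (a ** b) = (a ** b) ** z"
  by (metis matrix_mul_assoc)

lemma commutant_braid_xy:
  assumes "z \<in> burau_commutant"
  shows "z ** braid_x = braid_x ** z" "z ** braid_y = braid_y ** z"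
  using assms by (simp_all add: burau_commutant_def braid_x_def braid_y_def matrix_commute_mult)

text \<open>Reduced words of the free product of Z/2 and Z/3, cut into the complete blocks x y and x
  y^2. An initial power of y and a final x are kept outside, as the factors a and e of
  \<open>normal_forms\<close>.\<close>

inductive_set pos_words :: "lmat set" where
  one: "mat 1 \<in> pos_words"
| xy: "w \<in> pos_words \<Longrightarrow> w ** braid_x ** braid_y \<in> pos_words"
| xyy: "w \<in> pos_words \<Longrightarrow> w ** braid_x ** braid_y ** braid_y \<in> pos_words"

definition normal_forms :: "lmat set" where
  "normal_forms = {a ** w ** e ** z | a w e z. a \<in> {mat 1, braid_y, braid_y ** braid_y} \<and> w \<in> pos_words \<and>
     e \<in> {mat 1, braid_x} \<and> z \<in> burau_commutant}"

lemma normal_formsI: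
  "a \<in> {mat 1, braid_y, braid_y ** braid_y} \<Longrightarrow> w \<in> pos_words \<Longrightarrow> e \<in> {mat 1, braid_x} \<Longrightarrow> z \<in> burau_commutant \<Longrightarrow>
   n = a ** w ** e ** z \<Longrightarrow> n \<in> normal_forms"
  unfolding normal_forms_def by blast

lemma normal_forms_commutant:
  assumes "n \<in> normal_forms" "z \<in> burau_commutant" shows "n ** z \<in> normal_forms"
proof -
  obtain a w e z' where n: "a \<in> {mat 1, braid_y, braid_y ** braid_y}" "w \<in> pos_words" "e \<in> {mat 1, braid_x}"
    "z' \<in> burau_commutant" "n = a ** w ** e ** z'"
    using assms(1) unfolding normal_forms_def by blast
  show ?thesis
    by (rule normal_formsI[OF n(1-3) burau_commutant_mult[OF n(4) assms(2)]])
       (simp add: n(5) matrix_mul_assoc)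
qed

lemma normal_forms_braid_x:
  assumes "n \<in> normal_forms" shows "n ** braid_x \<in> normal_forms"
proof -
  obtain a w e z where n: "a \<in> {mat 1, braid_y, braid_y ** braid_y}" "w \<in> pos_words" "e \<in> {mat 1, braid_x}"
    "z \<in> burau_commutant" "n = a ** w ** e ** z"
    using assms unfolding normal_forms_def by blast
  have eq: "n ** braid_x = a ** w ** e ** braid_x ** z"
    by (metis n(5) commutant_braid_xy(1)[OF n(4)] matrix_mul_assoc)
  show ?thesis
  proof (cases "e = mat 1")
    case True
    then show ?thesis using eq by (intro normal_formsI[OF n(1,2) _ n(4), of braid_x]) simp_all
  next
    case False
    then have "e = braid_x" using n(3) by simp
    then have "n ** braid_x = a ** w ** mat 1 ** (full_twist ** z)" using eq by (simp add: full_twist_def matrix_mul_assoc)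
    then show ?thesis
      by (intro normal_formsI[OF n(1,2) _ burau_commutant_mult[OF full_twist_commutant(1) n(4)], of "mat 1"]) simp_all
  qed
qed

lemma normal_forms_braid_y:
  assumes "n \<in> normal_forms" shows "n ** braid_y \<in> normal_forms"
proof -
  obtain a w e z where n: "a \<in> {mat 1, braid_y, braid_y ** braid_y}" "w \<in> pos_words" "e \<in> {mat 1, braid_x}"
    "z \<in> burau_commutant" "n = a ** w ** e ** z"
    using assms unfolding normal_forms_def by blast
  have eq: "n ** braid_y = a ** w ** e ** braid_y ** z"
    by (metis n(5) commutant_braid_xy(2)[OF n(4)] matrix_mul_assoc)
  have cz: "full_twist ** z \<in> burau_commutant" by (rule burau_commutant_mult[OF full_twist_commutant(1) n(4)])
  show ?thesis
  proof (cases "e = mat 1")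
    case False
    then have "e = braid_x" using n(3) by simp
    then show ?thesis
      using eq by (intro normal_formsI[OF n(1) pos_words.xy[OF n(2)] _ n(4), of "mat 1"])
        (simp_all add: matrix_mul_assoc)
  next
    case e: True
    from n(2) show ?thesis
    proof cases
      case one
      consider "a = mat 1" | "a = braid_y" | "a = braid_y ** braid_y" using n(1) by blast
      then show ?thesis
      proof cases
        case 1
        then show ?thesis using eq e one
          by (intro normal_formsI[OF _ pos_words.one _ n(4), of braid_y "mat 1"]) simp_all
      next
        case 2
        then show ?thesis using eq e one
          by (intro normal_formsI[OF _ pos_words.one _ n(4), of "braid_y ** braid_y" "mat 1"]) simp_all
      next
        case 3
        then have "n ** braid_y = full_twist ** z" using eq e one burau_relations(1) by simp
        then show ?thesis
          by (intro normal_formsI[OF _ pos_words.one _ cz, of "mat 1" "mat 1"]) simp_all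
      qed
    next
      case (xy w')
      then show ?thesis using eq e
        by (intro normal_formsI[OF n(1) pos_words.xyy[OF xy(2)] _ n(4), of "mat 1"])
           (simp_all add: matrix_mul_assoc)
    next
      case (xyy w')
      \<comment> \<open>The new y completes y^3, which is the full twist and moves into the
        commutant; the last block breaks up and its x becomes the tail e.\<close>
      have "n ** braid_y = a ** w' ** braid_x ** (braid_y ** braid_y ** braid_y) ** z"
        using eq e xyy(1) by (simp add: matrix_mul_assoc)
      then have "n ** braid_y = a ** w' ** braid_x ** (full_twist ** z)"
        by (simp only: burau_relations(1) matrix_mul_assoc)
      then show ?thesis
        by (intro normal_formsI[OF n(1) xyy(2) _ cz, of braid_x]) simp_all
    qed
  qed
qed

text \<open>Inserting the full twist and its inverse turns the letter s into a positive word in x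
  and y, and the leftover inverse is absorbed by the commutant.\<close>

lemma normal_forms_generators:
  assumes "n \<in> normal_forms"
    and "s \<in> {burau_s1, burau_s2, burau_s1_inv, burau_s2_inv}"
  shows "n ** s \<in> normal_forms"
proof -
  have "n ** s = n ** (s ** full_twist) ** full_twist_inv"
    using full_twist_inverse(1) by (metis matrix_mul_assoc matrix_mul_rid)
  moreover have "n ** r \<in> normal_forms"
    if "r \<in> {braid_y ** braid_y ** braid_x, braid_x ** braid_y ** braid_y, braid_x ** braid_y, braid_y ** braid_x}" for r
    using assms(1) that by (auto simp: matrix_mul_assoc normal_forms_braid_x normal_forms_braid_y)
  then have "n ** (s ** full_twist) \<in> normal_forms"
    using assms(2) by (auto simp: burau_relations)
  ultimately show ?thesis using normal_forms_commutant full_twist_commutant(2) by simp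
qed

lemma inv_burau:
  "inv\<^bsub>Gamma_grp\<^esub> burau_s1 = burau_s1_inv" "inv\<^bsub>Gamma_grp\<^esub> burau_s2 = burau_s2_inv"
  by (rule monoid.inv_char[OF monoid_Gamma];
      simp add: Gamma_grp_def burau_in_Gamma burau_inverse)+

lemma burau_image_normal_form:
  assumes "b \<in> burau_image" shows "b \<in> normal_forms"
proof -
  \<comment> \<open>Stated for right multiplication on every normal form, so that products in
    \<open>generate\<close> are handled by composition.\<close>
  have "n ** b \<in> normal_forms" if "n \<in> normal_forms" for n
    using assms that unfolding burau_image_def
  proof (induction arbitrary: n rule: generate.induct)
    case one
    then show ?case by (simp add: Gamma_grp_def)
  next
    case (incl h)
    then show ?case using normal_forms_generators by auto
  next
    case (inv h)
    then show ?case using normal_forms_generators by (auto simp: inv_burau)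
  next
    case (eng h1 h2)
    then show ?case by (simp add: Gamma_grp_def matrix_mul_assoc)
  qed
  moreover have "mat 1 \<in> normal_forms"
    by (rule normal_formsI[OF _ pos_words.one _ burau_commutant_one, of "mat 1" "mat 1"]) simp_all
  ultimately show ?thesis by (metis matrix_mul_lid)
qed

lemma pos_words_Gamma: "w \<in> pos_words \<Longrightarrow> w \<in> Gamma"
  by (induction rule: pos_words.induct) (simp_all add: Gamma_one Gamma_mult braid_xy_Gamma)

lemma normal_forms_Gamma: "n \<in> normal_forms \<Longrightarrow> n \<in> Gamma"
  unfolding normal_forms_def
  by (auto intro!: Gamma_mult simp: pos_words_Gamma Gamma_one braid_xy_Gamma burau_commutant_def)

lemma red_at_m1_braid_xy:
  "red_at_m1 braid_x = mat2 0 (- 1) 1 0" "red_at_m1 braid_y = mat2 1 (- 1) 1 0"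
  by (simp_all add: braid_x_def braid_y_def red_at_m1_Gamma_mult Gamma_mult burau_in_Gamma
      red_at_m1_burau mat2_mult)

text \<open>Ping-pong: at \<open>t = -1\<close>, both \<open>x y\<close> and \<open>x y\<^sup>2\<close> are up to sign matrices with positive diagonal
  and non-positive off-diagonal entries, a sign pattern that is stable under products.\<close>

lemma pos_words_at_m1:
  assumes "w \<in> pos_words"
  shows "w = mat 1 \<or> (\<exists>\<epsilon> p q r s. (\<epsilon> = 1 \<or> \<epsilon> = - 1) \<and> p \<ge> 1 \<and> q \<ge> 0 \<and> r \<ge> 0 \<and> s \<ge> 1 \<and> q + r \<ge> 1 \<and>
    red_at_m1 w = mat2 (\<epsilon> * p) (- (\<epsilon> * q)) (- (\<epsilon> * r)) (\<epsilon> * s))"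
  (is "_ \<or> ?P w")
  using assms
proof induction
  case one
  then show ?case by simp
next
  case (xy w)
  note G = pos_words_Gamma[OF xy.hyps] braid_xy_Gamma
  have eq: "red_at_m1 (w ** braid_x ** braid_y) = red_at_m1 w ** mat2 (- 1) 0 1 (- 1)"
    by (simp add: red_at_m1_Gamma_mult Gamma_mult G red_at_m1_braid_xy matrix_mul_assoc[symmetric] mat2_mult)
  from xy.IH have "?P (w ** braid_x ** braid_y)"
  proof
    assume w: "w = mat 1"
    show ?thesis unfolding eq
      by (rule exI[of _ "- 1"], rule exI[of _ 1], rule exI[of _ 0], rule exI[of _ 1], rule exI[of _ 1])
         (simp add: w red_at_m1_one mat2_mult)
  next
    assume "?P w"
    then obtain \<epsilon> p q r s where h: "\<epsilon> = 1 \<or> \<epsilon> = - 1" "p \<ge> 1" "q \<ge> 0" "r \<ge> 0" "s \<ge> 1" "q + r \<ge> 1"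
      "red_at_m1 w = mat2 (\<epsilon> * p) (- (\<epsilon> * q)) (- (\<epsilon> * r)) (\<epsilon> * s)" by blast
    show ?thesis unfolding eq
      by (rule exI[of _ "- \<epsilon>"], rule exI[of _ "p + q"], rule exI[of _ q], rule exI[of _ "r + s"], rule exI[of _ s])
         (use h(1-6) in \<open>simp add: h(7) mat2_mult algebra_simps, linarith?\<close>)
  qed
  then show ?case ..
next
  case (xyy w)
  note G = pos_words_Gamma[OF xyy.hyps] braid_xy_Gamma
  have eq: "red_at_m1 (w ** braid_x ** braid_y ** braid_y) = red_at_m1 w ** mat2 (- 1) 1 0 (- 1)"
    by (simp add: red_at_m1_Gamma_mult Gamma_mult G red_at_m1_braid_xy matrix_mul_assoc[symmetric] mat2_mult)
  from xyy.IH have "?P (w ** braid_x ** braid_y ** braid_y)"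
  proof
    assume w: "w = mat 1"
    show ?thesis unfolding eq
      by (rule exI[of _ "- 1"], rule exI[of _ 1], rule exI[of _ 1], rule exI[of _ 0], rule exI[of _ 1])
         (simp add: w red_at_m1_one mat2_mult)
  next
    assume "?P w"
    then obtain \<epsilon> p q r s where h: "\<epsilon> = 1 \<or> \<epsilon> = - 1" "p \<ge> 1" "q \<ge> 0" "r \<ge> 0" "s \<ge> 1" "q + r \<ge> 1"
      "red_at_m1 w = mat2 (\<epsilon> * p) (- (\<epsilon> * q)) (- (\<epsilon> * r)) (\<epsilon> * s)" by blast
    show ?thesis unfolding eq
      by (rule exI[of _ "- \<epsilon>"], rule exI[of _ p], rule exI[of _ "p + q"], rule exI[of _ r], rule exI[of _ "r + s"])
         (use h(1-6) in \<open>simp add: h(7) mat2_mult algebra_simps, linarith?\<close>)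
  qed
  then show ?case ..
qed

text \<open>This is injectivity of the map to PSL(2, Z): a normal form that is scalar at -1 has only
  its commutant factor left.\<close>

lemma burau_image_scalar:
  assumes "b \<in> burau_image" "red_at_m1 b = mat2 l 0 0 l"
  shows "b \<in> burau_commutant"
proof -
  obtain a w e z where b: "a \<in> {mat 1, braid_y, braid_y ** braid_y}" "w \<in> pos_words" "e \<in> {mat 1, braid_x}"
    "z \<in> burau_commutant" "b = a ** w ** e ** z"
    using burau_image_normal_form[OF assms(1)] unfolding normal_forms_def by blast
  obtain m where m: "m = 1 \<or> m = - 1" "red_at_m1 z = mat2 m 0 0 m"
    using red_at_m1_commutant[OF b(4)] by blast
  have G: "a \<in> Gamma" "w \<in> Gamma" "e \<in> Gamma" "z \<in> Gamma"
    using b by (auto simp: pos_words_Gamma braid_xy_Gamma Gamma_one Gamma_mult burau_commutant_def)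
  have eq: "red_at_m1 a ** red_at_m1 w ** red_at_m1 e ** mat2 m 0 0 m = mat2 l 0 0 l"
    using assms(2) by (simp add: b(5) red_at_m1_Gamma_mult Gamma_mult G m(2))
  have "w = mat 1 \<and> a = mat 1 \<and> e = mat 1"
  proof (cases "w = mat 1")
    case True
    then show ?thesis
      using eq b(1,3) m(1)
      by (auto simp: red_at_m1_one red_at_m1_braid_xy red_at_m1_Gamma_mult braid_xy_Gamma mat2_mult)
  next
    case False
    then obtain \<epsilon> p q r s where h: "\<epsilon> = 1 \<or> \<epsilon> = - 1" "p \<ge> 1" "q \<ge> 0" "r \<ge> 0" "s \<ge> 1" "q + r \<ge> 1"
      "red_at_m1 w = mat2 (\<epsilon> * p) (- (\<epsilon> * q)) (- (\<epsilon> * r)) (\<epsilon> * s)"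
      using pos_words_at_m1[OF b(2)] by blast
    \<comment> \<open>For a = e = 1 the bound q + r >= 1 gives a nonzero off-diagonal entry. In the
      five other products one off-diagonal entry is, up to sign, p or s plus a non-negative term,
      hence nonzero.\<close>
    have False
      using eq b(1,3) m(1) h(1-6) unfolding h(7)
      by (auto simp: red_at_m1_one red_at_m1_braid_xy red_at_m1_Gamma_mult braid_xy_Gamma mat2_mult)
    then show ?thesis ..
  qed
  then show ?thesis using b(4,5) by simp
qed

subsection \<open>Powers of an element trivial at -1\<close>

primrec mat_pow :: "lmat \<Rightarrow> nat \<Rightarrow> lmat" where
  "mat_pow A 0 = mat 1"
| "mat_pow A (Suc n) = A ** mat_pow A n"

lemma mat_pow_Gamma: "A \<in> Gamma \<Longrightarrow> mat_pow A n \<in> Gamma"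
  by (induction n) (simp_all add: Gamma_one Gamma_mult)

lemma mat_pow_add: "mat_pow A (m + n) = mat_pow A m ** mat_pow A n"
  by (induction m) (simp_all add: matrix_mul_assoc)

lemma mat_pow_commute: "A ** mat_pow A n = mat_pow A n ** A"
  by (induction n) (simp, metis mat_pow.simps(2) matrix_mul_assoc)

lemma mat_pow_inverse: "A ** B = mat 1 \<Longrightarrow> mat_pow A n ** mat_pow B n = mat 1"
proof (induction n)
  case (Suc n)
  have "mat_pow A (Suc n) ** mat_pow B (Suc n) = mat_pow A n ** (A ** B) ** mat_pow B n"
    by (simp only: mat_pow.simps mat_pow_commute[of A] matrix_mul_assoc)
  then show ?case using Suc by simp
qed simp

lemma red_at_m1_mat_pow_one:
  "A \<in> Gamma \<Longrightarrow> red_at_m1 A = mat2 1 0 0 1 \<Longrightarrow> red_at_m1 (mat_pow A n) = mat2 1 0 0 1"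
  by (induction n) (simp_all add: red_at_m1_one red_at_m1_Gamma_mult mat_pow_Gamma mat2_mult)

text \<open>By Cayley--Hamilton the \<open>n\<close>-th power of a 2 by 2 matrix \<open>M\<close> is \<open>U M + V\<close>; if \<open>M\<close> is the
  identity at \<open>t = -1\<close>, then \<open>U\<close> takes the value \<open>n\<close> there.\<close>

lemma red_mat_pow:
  assumes "A \<in> Gamma" and red: "red A = mat2 p q r s" and "red_at_m1 A = mat2 1 0 0 1"
  shows "\<exists>U V. laurent_poly U \<and> laurent_poly V \<and>
    eval_unit (- 1) U = int n \<and> eval_unit (- 1) V = 1 - int n \<and>
    red (mat_pow A n) = mat2 (U * p + V) (U * q) (U * r) (U * s + V)"
proof -
  have l: "laurent_poly p" "laurent_poly q" "laurent_poly r" "laurent_poly s"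
    using laurent_poly_red[OF Gamma_laurent[OF assms(1)], of 1 1]
      laurent_poly_red[OF Gamma_laurent[OF assms(1)], of 1 2]
      laurent_poly_red[OF Gamma_laurent[OF assms(1)], of 2 1]
      laurent_poly_red[OF Gamma_laurent[OF assms(1)], of 2 2] by (simp_all add: red)
  have e: "eval_unit (- 1) p = 1" "eval_unit (- 1) q = 0" "eval_unit (- 1) r = 0" "eval_unit (- 1) s = 1"
    using assms(3) red_at_m1_mat2[OF red] by simp_all
  show ?thesis
  proof (induction n)
    case 0
    show ?case by (rule exI[of _ 0], rule exI[of _ 1]) (simp add: red_one)
  next
    case (Suc n)
    then obtain U V where UV: "laurent_poly U" "laurent_poly V"
      "eval_unit (- 1) U = int n" "eval_unit (- 1) V = 1 - int n"
      "red (mat_pow A n) = mat2 (U * p + V) (U * q) (U * r) (U * s + V)" by blast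
    have "red (mat_pow A (Suc n)) = mat2 p q r s ** mat2 (U * p + V) (U * q) (U * r) (U * s + V)"
      by (simp add: red_mult Gamma_fixes_ones assms(1) red UV(5))
    \<comment> \<open>The square of the matrix is its trace times itself minus its determinant. At
      -1 the trace is 2 and the determinant 1, so U and V take the values 2 n + (1 - n) = n + 1 and
      -n.\<close>
    also have "\<dots> = mat2 ((U * (p + s) + V) * p + U * (q * r - p * s)) ((U * (p + s) + V) * q)
        ((U * (p + s) + V) * r) ((U * (p + s) + V) * s + U * (q * r - p * s))"
      by (simp add: mat2_mult algebra_simps)
    finally show ?case
      by (intro exI[of _ "U * (p + s) + V"] exI[of _ "U * (q * r - p * s)"])
         (simp add: UV l e eval_unit_add eval_unit_diff eval_unit_mult)
  qed
qed

text \<open>Commuting with the lower triangular \<open>red burau_s1\<close> forces the upper right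
  entry U q to vanish, but q is nonzero and U has the value n > 0 at -1.\<close>

lemma mat_pow_not_commutant:
  assumes "A \<in> Gamma" "red_at_m1 A = mat2 1 0 0 1" "red A $ 1 $ 2 \<noteq> 0" "n > 0"
  shows "mat_pow A n \<notin> burau_commutant"
proof
  assume comm: "mat_pow A n \<in> burau_commutant"
  obtain p q r s where red: "red A = mat2 p q r s" by (rule mat2_cases)
  obtain U V where UV: "eval_unit (- 1) U = int n"
    "red (mat_pow A n) = mat2 (U * p + V) (U * q) (U * r) (U * s + V)"
    using red_mat_pow[OF assms(1) red assms(2)] by blast
  have "mat_pow A n ** burau_s1 = burau_s1 ** mat_pow A n"
    using comm by (simp add: burau_commutant_def)
  then have "red (mat_pow A n) ** red burau_s1 = red burau_s1 ** red (mat_pow A n)"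
    using red_mult Gamma_fixes_ones mat_pow_Gamma[OF assms(1)] burau_in_Gamma(1) by metis
  then have "U * q = 0"
    by (simp add: UV(2) red_burau mat2_mult algebra_simps)
  moreover have "q \<noteq> 0" using assms(3) by (simp add: red)
  ultimately have "U = 0" by simp
  then show False using UV(1) assms(4) by simp
qed

lemma grp_center_commutant: "z \<in> grp_center Gamma_grp \<Longrightarrow> z \<in> burau_commutant"
  by (simp add: grp_center_def burau_commutant_def Gamma_grp_def burau_in_Gamma)

text \<open>The braid group modulo its centre embeds into \<open>PSL\<^sub>2(\<int>)\<close> by specialisation at \<open>t = -1\<close>,
  so the powers of \<open>A\<close> are inequivalent modulo the Burau image and the centre.\<close>

lemma mat_pow_inequivalent:
  assumes A: "A \<in> Gamma" "red_at_m1 A = mat2 1 0 0 1" "red A $ 1 $ 2 \<noteq> 0"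
    and z: "z1 \<in> grp_center Gamma_grp" "z2 \<in> grp_center Gamma_grp" and b: "b \<in> burau_image"
    and "m < n"
  shows "mat_pow A n \<noteq> z1 ** b ** z2 ** mat_pow A m"
proof
  assume eq: "mat_pow A n = z1 ** b ** z2 ** mat_pow A m"
  have zc: "z1 \<in> burau_commutant" "z2 \<in> burau_commutant"
    using z by (simp_all add: grp_center_commutant)
  have G: "z1 \<in> Gamma" "z2 \<in> Gamma" "b \<in> Gamma"
    using zc normal_forms_Gamma burau_image_normal_form[OF b] by (auto simp: burau_commutant_def)
  obtain l1 l2 where l: "l1 = 1 \<or> l1 = - 1" "red_at_m1 z1 = mat2 l1 0 0 l1"
    "l2 = 1 \<or> l2 = - 1" "red_at_m1 z2 = mat2 l2 0 0 l2"
    using red_at_m1_commutant[OF zc(1)] red_at_m1_commutant[OF zc(2)] by metis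
  obtain p q r s where bm: "red_at_m1 b = mat2 p q r s" by (rule mat2_cases)
  have "mat2 1 0 0 1 = red_at_m1 z1 ** red_at_m1 b ** red_at_m1 z2 ** mat2 1 0 0 1"
    using arg_cong[OF eq, of red_at_m1]
    by (simp add: red_at_m1_Gamma_mult Gamma_mult G mat_pow_Gamma A(1) red_at_m1_mat_pow_one A(2))
  then have "p = s \<and> q = 0 \<and> r = 0"
    using l(1,3) by (auto simp: l(2,4) bm mat2_mult)
  then have "b \<in> burau_commutant" using burau_image_scalar[OF b] bm by auto
  then have w: "z1 ** b ** z2 \<in> burau_commutant"
    using zc by (intro burau_commutant_mult)
  obtain B where "mat_pow A m ** B = mat 1"
    using Gamma_inverse[OF mat_pow_Gamma[OF A(1)]] by blast
  moreover have "mat_pow A (n - m) ** mat_pow A m = z1 ** b ** z2 ** mat_pow A m"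
    using eq \<open>m < n\<close> by (simp add: mat_pow_add[symmetric])
  ultimately have "mat_pow A (n - m) = z1 ** b ** z2"
    by (metis matrix_mul_assoc matrix_mul_rid)
  then show False
    using w mat_pow_not_commutant[OF A, of "n - m"] \<open>m < n\<close> by simp
qed

text \<open>At -1 the witness has determinant 1 and upper left entry 1, so it splits there into a
  lower and an upper unitriangular factor with entries 6 and -20, the values of s1^6 and s2^20. Both
  are cancelled here.\<close>

definition kernel_elt :: lmat where
  "kernel_elt = mat_pow burau_s1_inv 6 ** witness ** mat_pow burau_s2_inv 20"

lemma kernel_elt_Gamma: "kernel_elt \<in> Gamma"
  by (simp add: kernel_elt_def Gamma_mult mat_pow_Gamma burau_in_Gamma witness_in_Gamma)

lemma red_at_m1_mat_pow:
  "red_at_m1 (mat_pow burau_s1_inv n) = mat2 1 0 (- int n) 1"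
  "red_at_m1 (mat_pow burau_s2_inv n) = mat2 1 (int n) 0 1"
  by (induction n) (simp_all add: red_at_m1_one red_at_m1_Gamma_mult mat_pow_Gamma burau_in_Gamma
      red_at_m1_burau mat2_mult)

lemma red_at_m1_witness: "red_at_m1 witness = mat2 1 (- 20) 6 (- 119)"
  by (subst red_at_m1_mat2[OF red_def])
     (simp add: witness_def witness_list_def ltl_mat_def eval_unit_diff eval_unit_ltl_0_Cons)

lemma red_at_m1_kernel_elt: "red_at_m1 kernel_elt = mat2 1 0 0 1"
  by (simp add: kernel_elt_def red_at_m1_Gamma_mult Gamma_mult mat_pow_Gamma burau_in_Gamma
      witness_in_Gamma red_at_m1_mat_pow red_at_m1_witness mat2_mult)

lemma red_mat_pow_s1: "red (mat_pow burau_s1 n) $ 1 $ 2 = 0"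
proof (induction n)
  case (Suc n)
  obtain p q r s where "red (mat_pow burau_s1 n) = mat2 p q r s" by (rule mat2_cases)
  then show ?case using Suc
    by (simp add: red_mult Gamma_fixes_ones burau_in_Gamma red_burau mat2_mult)
qed (simp add: red_one)

text \<open>Only the shape matters: the entries involve no negative powers of t, and the upper right
  one is divisible by t.\<close>

lemma red_mat_pow_s2: "\<exists>cs ds. red (mat_pow burau_s2 n) = mat2 1 (t * lp cs) 0 (lp ds)"
proof (induction n)
  case 0
  have "t * lp [] = 0" "lp [1] = 1" by simp_all
  then show ?case unfolding mat_pow.simps red_one by metis
next
  case (Suc n)
  then obtain cs ds where "red (mat_pow burau_s2 n) = mat2 1 (t * lp cs) 0 (lp ds)" by blast
  then have "red (mat_pow burau_s2 (Suc n)) =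
      mat2 1 (t * lp (ladd cs ds)) 0 (lp (0 # map ((*) (- 1)) ds))"
    by (simp add: red_mult Gamma_fixes_ones burau_in_Gamma red_burau mat2_mult
        lp_add[symmetric] lp_map algebra_simps del: lp.simps)
       (simp add: lp_map)
  then show ?case by blast
qed

lemma witness_factorisation:
  "witness = mat_pow burau_s1 6 ** kernel_elt ** mat_pow burau_s2 20"
proof -
  have "mat_pow burau_s1 6 ** kernel_elt ** mat_pow burau_s2 20 =
    (mat_pow burau_s1 6 ** mat_pow burau_s1_inv 6) ** witness **
    (mat_pow burau_s2_inv 20 ** mat_pow burau_s2 20)"
    unfolding kernel_elt_def by (simp only: matrix_mul_assoc)
  then show ?thesis by (simp add: mat_pow_inverse burau_inverse)
qed

lemma fls_nth_lp_neg: "n < 0 \<Longrightarrow> fls_nth (lp cs) n = 0"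
  by (induction cs arbitrary: n) (auto simp: fls_X_times_conv_shift)

lemma fls_nth_lp_1: "fls_nth (lp (a # c # cs)) 1 = c"
  by (simp add: fls_X_times_conv_shift fls_nth_lp_neg)

text \<open>If the entry vanished, the reduced witness would have a first row of the form
  \<open>(f, f t g)\<close>, which is impossible as the entries of that row vanish at \<open>t = 0\<close> to order
  exactly 1.\<close>

lemma red_kernel_elt: "red kernel_elt $ 1 $ 2 \<noteq> 0"
proof
  assume k0: "red kernel_elt $ 1 $ 2 = 0"
  obtain p q r s where k: "red kernel_elt = mat2 p q r s" by (rule mat2_cases)
  obtain p' q' r' s' where s1: "red (mat_pow burau_s1 6) = mat2 p' q' r' s'" by (rule mat2_cases)
  obtain cs ds where s2: "red (mat_pow burau_s2 20) = mat2 1 (t * lp cs) 0 (lp ds)"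
    using red_mat_pow_s2 by blast
  have zero: "q = 0" "q' = 0" using k0 red_mat_pow_s1[of 6] by (simp_all add: k s1)
  have G: "mat_pow burau_s1 6 \<in> Gamma" "kernel_elt \<in> Gamma"
    by (simp_all add: mat_pow_Gamma burau_in_Gamma kernel_elt_Gamma)
  have "red witness = mat2 p' q' r' s' ** mat2 p q r s ** mat2 1 (t * lp cs) 0 (lp ds)"
    by (subst witness_factorisation)
       (simp add: red_mult Gamma_fixes_ones Gamma_mult G s1 k s2)
  \<comment> \<open>The two left factors are lower triangular, so their product has first row (f,
    0).\<close>
  then have row: "red witness $ 1 $ 2 = red witness $ 1 $ 1 * (t * lp cs)"
    by (simp add: mat2_mult zero)
  \<comment> \<open>Both terms of the upper left entry have constant term 1; it cancels, so f is
    divisible by t and f t g by t^2, whereas the actual upper right entry has coefficient -1 at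
    t.\<close>
  have cancel: "lp (c # xs) - lp (c # ys) = t * lp (ladd xs (map ((*) (- 1)) ys))" for c xs ys
    by (simp add: lp_diff[symmetric] algebra_simps)
  obtain L where "red witness $ 1 $ 1 = t * lp L"
    by (simp add: red_def witness_def witness_list_def ltl_mat_def ltl_def cancel del: lp.simps)
  then have "red witness $ 1 $ 2 = lp (0 # 0 # lmul L cs)"
    using row by (simp add: lp_mult[symmetric] algebra_simps)
  moreover have "fls_nth (red witness $ 1 $ 2) 1 = - 1"
    by (simp add: red_def witness_def witness_list_def ltl_mat_def ltl_def fls_nth_lp_1 del: lp.simps)
  ultimately show False by (simp only: fls_nth_lp_1)
qed

subsection \<open>The coset space\<close>

lemma qmap_self: "A \<in> qmap A"
proof -
  have "mat 1 \<in> grp_center Gamma_grp" by (simp add: grp_center_def Gamma_grp_def Gamma_one)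
  then show ?thesis
    by (auto simp: qmap_def r_coset_def Gamma_grp_def intro!: bexI[of _ "mat 1"])
qed

lemma qmap_carrier: "A \<in> Gamma \<Longrightarrow> qmap A \<in> carrier Gamma_bar"
  by (auto simp: qmap_def Gamma_bar_def FactGroup_def RCOSETS_def Gamma_grp_def)

lemma one_burau_image: "mat 1 \<in> burau_image"
  using generate.one[of Gamma_grp] by (simp add: burau_image_def Gamma_grp_def)

text \<open>Multiplication in \<open>Gamma_bar\<close> is the product of sets, so comparing one
  representative suffices; the two classes on the right contribute the two central factors. The
  factor \<open>qmap (mat 1)\<close> puts the element literally into the coset of the n-th power, so
  no group law of the quotient is invoked.\<close>

lemma qmap_cosets_inequivalent:
  assumes "m < n"
  shows "qmap (mat 1) \<otimes>\<^bsub>Gamma_bar\<^esub> qmap (mat_pow kernel_elt n) \<notin>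
    qmap ` burau_image #>\<^bsub>Gamma_bar\<^esub> qmap (mat_pow kernel_elt m)"
proof
  assume "qmap (mat 1) \<otimes>\<^bsub>Gamma_bar\<^esub> qmap (mat_pow kernel_elt n) \<in>
    qmap ` burau_image #>\<^bsub>Gamma_bar\<^esub> qmap (mat_pow kernel_elt m)"
  then obtain b where b: "b \<in> burau_image"
    "qmap (mat 1) <#>\<^bsub>Gamma_grp\<^esub> qmap (mat_pow kernel_elt n) =
     qmap b <#>\<^bsub>Gamma_grp\<^esub> qmap (mat_pow kernel_elt m)"
    by (auto simp: r_coset_def Gamma_bar_def FactGroup_def)
  have "mat 1 ** mat_pow kernel_elt n \<in> qmap (mat 1) <#>\<^bsub>Gamma_grp\<^esub> qmap (mat_pow kernel_elt n)"
    using qmap_self[of "mat 1"] qmap_self[of "mat_pow kernel_elt n"]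
    unfolding set_mult_def Gamma_grp_def by (auto simp del: matrix_mul_lid matrix_mul_rid)
  then obtain z1 z2 where "z1 \<in> grp_center Gamma_grp" "z2 \<in> grp_center Gamma_grp"
    "mat_pow kernel_elt n = (z1 ** b) ** (z2 ** mat_pow kernel_elt m)"
    unfolding b(2) by (auto simp: set_mult_def qmap_def r_coset_def Gamma_grp_def)
  then show False
    using mat_pow_inequivalent[OF kernel_elt_Gamma red_at_m1_kernel_elt red_kernel_elt _ _ b(1) assms]
    by (simp add: matrix_mul_assoc)
qed

theorem theorem1p1:
  shows "qmap ` burau_image \<noteq> carrier Gamma_bar \<and>
         infinite (rcosets\<^bsub>Gamma_bar\<^esub> (qmap ` burau_image))"
proof
  let ?k = "\<lambda>n. mat_pow kernel_elt n"
  let ?H = "qmap ` burau_image"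
  show "?H \<noteq> carrier Gamma_bar"
  proof
    assume "?H = carrier Gamma_bar"
    then obtain b where b: "b \<in> burau_image" "qmap (?k 1) = qmap b"
      using qmap_carrier[OF mat_pow_Gamma[OF kernel_elt_Gamma, of 1]] by blast
    then have "?k 1 \<in> qmap b" using qmap_self by metis
    \<comment> \<open>Padded with \<open>mat 1\<close> and the zeroth power to fit the inequivalence
      of powers with exponents 0 and 1.\<close>
    then obtain z where "z \<in> grp_center Gamma_grp" "?k 1 = z ** b ** mat 1 ** ?k 0"
      by (auto simp: qmap_def r_coset_def Gamma_grp_def)
    moreover have "mat 1 \<in> grp_center Gamma_grp"
      by (simp add: grp_center_def Gamma_grp_def Gamma_one)
    ultimately show False
      using mat_pow_inequivalent[OF kernel_elt_Gamma red_at_m1_kernel_elt red_kernel_elt _ _ b(1), of z "mat 1" 0 1]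
      by simp
  qed
  have coset_self: "qmap (mat 1) \<otimes>\<^bsub>Gamma_bar\<^esub> qmap (?k n) \<in> ?H #>\<^bsub>Gamma_bar\<^esub> qmap (?k n)" for n
    using one_burau_image by (auto simp: r_coset_def)
  \<comment> \<open>For m < n, the n-th coset contains an element that the m-th coset lacks, which
    already separates them.\<close>
  have "inj (\<lambda>n. ?H #>\<^bsub>Gamma_bar\<^esub> qmap (?k n))"
  proof (rule linorder_injI)
    fix m n :: nat assume "m < n"
    then show "?H #>\<^bsub>Gamma_bar\<^esub> qmap (?k m) \<noteq> ?H #>\<^bsub>Gamma_bar\<^esub> qmap (?k n)"
      using coset_self[of n] qmap_cosets_inequivalent by metis
  qed
  moreover have "range (\<lambda>n. ?H #>\<^bsub>Gamma_bar\<^esub> qmap (?k n)) \<subseteq> rcosets\<^bsub>Gamma_bar\<^esub> ?H"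
    using qmap_carrier[OF mat_pow_Gamma[OF kernel_elt_Gamma]] by (auto simp: RCOSETS_def)
  ultimately show "infinite (rcosets\<^bsub>Gamma_bar\<^esub> ?H)"
    using range_inj_infinite infinite_super by blast
qed

end
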